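(* Let $\Gamma$ be a locally finite graph, $F$ a field with an absolute value $|\cdot|_{\rm v}$, $F_0$ the prime subfield of $F$, and $\lambda\in F$. Let $v\in S_{F,\lambda}(\Gamma)$. Then: 1) There is a finite subset $X\subseteq V(\Gamma)$ containing $v$ such that the induced subgraph $\langle X\rangle_\Gamma$ is connected, $\lambda$ is an eigenvalue of the adjacency matrix of $\langle X\rangle_\Gamma$ over $F$, and there is an eigenfunction of the adjacency matrix of $\langle X\rangle_\Gamma$ over $F$ corresponding to $\lambda$ which lies in $(F_0(\lambda))^X$ and has support equal to $X$. Moreover, there is a finite subset $Y\subseteq V(\Gamma)$ containing $X$ such that the subgraph $\langle Y\rangle_{\Gamma^2}$ of $\Gamma^2$ induced by $Y$ is connected and, for every finite subset $Z\subseteq V(\Gamma)$ containing $Y$, $\lambda$ is an eigenvalue of the adjacency matrix of $\langle Z\rangle_\Gamma$ over $F$, with a corresponding eigenfunction lying in $(F_0(\lambda))^Z$ and having support equal to $Y$. In particular, $\lambda$ is algebraic over $F_0$ (and the field $F_0(\lambda)$ is finite if $F$ has positive characteristic). 2) Suppose $F$ has characteristic $0$ (so $F_0=\mathbb{Q}$), and let $X$ be as in the first sentence of 1), i.e. $X$ is a finite subset of $V(\Gamma)$ containing $v$ with $\langle X\rangle_\Gamma$ connected, such that $\lambda$ is an eigenvalue of the adjacency matrix of $\langle X\rangle_\Gamma$ over $F$ with a corresponding eigenfunction lying in $(F_0(\lambda))^X$ with support $X$. Then $\lambda$ is a root of a monic polynomial in $\mathbb{Z}[x]$ of degree $|X|$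 all of whose (complex) roots are real and do not exceed in the usual absolute value the maximum of the degrees of the vertices of the graph $\langle X\rangle_\Gamma$ (and hence do not exceed in absolute value the maximum of the degrees in $\Gamma$ of the vertices of $X$, this latter maximum being attained only if $X$ is the connected component of $\Gamma$ containing $v$ and $\langle X\rangle_\Gamma$ is a finite regular graph).
   Context: A graph is an undirected graph without loops or multiple edges, with vertex set $V(\Gamma)$; $\Gamma(v)$ is the set of vertices adjacent to $v$. $\Gamma$ is locally finite if every $\Gamma(v)$ is finite. $F^{V(\Gamma)}$ is the $F$-vector space of all functions $V(\Gamma)\to F$, and $A_{\Gamma,F}$ is the linear operator on it given by $(A_{\Gamma,F}(f))(v)=\sum_{u\in\Gamma(v)}f(u)$; $E$ is the identity operator. The absolute value may be trivial. $\delta_v$ is the function equal to $1$ at $v$ and $0$ elsewhere. An $(F,\lambda)$-propagator of $\Gamma$ with respect to $v$ is any $f\in F^{V(\Gamma)}$ with $(A_{\Gamma,F}-\lambda E)(f)=\delta_v$; $S_{F,\lambda}(\Gamma)$ is the set of all vertices with respect to which $\Gamma$ has no $(F,\lambda)$-propagator. $\langle X\rangle_\Gamma$ is the subgraph of $\Gamma$ induced by $X$. $\Gamma^2$ is the graph with vertex set $V(\Gamma)$ in which two distinct vertices are adjacent iff they are joined in $\Gamma$ by a path of length at most $2$. An eigenfunction of the adjacency matrix of a finite graph $\Delta$ over $F$ for $\lambda$ is a nonzero $f\in F^{V(\Delta)}$ with $\sum_{u\in\Delta(w)}f(u)=\lambda f(w)$ for all $w\in V(\Delta)$; its support is the set where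 it is nonzero. *)

theory Defs
  imports
    "HOL-Library.FuncSet"
    "HOL-Computational_Algebra.Computational_Algebra"
    "Graph_Theory.Graph_Theory"
begin

section \<open>Graphs\<close>

text \<open>
  As in the session Graph_Theory, an undirected graph is a symmetric digraph. The locale
  \<open>graph\<close> of that session assumes finiteness, so infinite graphs need a locale of their own.
\<close>

locale simple_graph = sym_digraph + loopfree_digraph + nomulti_digraph

definition neighbours :: "('v, 'e) pre_digraph \<Rightarrow> 'v \<Rightarrow> 'v set" where
  "neighbours G v = {u. v \<rightarrow>\<^bsub>G\<^esub> u}"

definition vertex_degree :: "('v, 'e) pre_digraph \<Rightarrow> 'v \<Rightarrow> nat" where
  "vertex_degree G v = card (neighbours G v)"

definition locally_finite :: "('v, 'e) pre_digraph \<Rightarrow> bool" where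
  "locally_finite G \<longleftrightarrow> (\<forall>v\<in>verts G. finite (neighbours G v))"

definition regular_graph :: "('v, 'e) pre_digraph \<Rightarrow> bool" where
  "regular_graph G \<longleftrightarrow> (\<exists>k. \<forall>v\<in>verts G. vertex_degree G v = k)"

definition component_verts :: "('v, 'e) pre_digraph \<Rightarrow> 'v \<Rightarrow> 'v set" where
  "component_verts G v = {u. v \<rightarrow>\<^sup>*\<^bsub>G\<^esub> u}"

definition graph_square :: "('v, 'e) pre_digraph \<Rightarrow> ('v, 'v \<times> 'v) pre_digraph" where
  "graph_square G =
     \<lparr> verts = verts G,
       arcs = {(u, w). u \<noteq> w \<and> (\<exists>p. pre_digraph.apath G u p w \<and> length p \<le> 2)},
       tail = fst, head = snd \<rparr>"

text \<open>
  The name \<open>connected\<close> also denotes topological connectedness; the graph-theoretic predicate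
  requires a nonempty vertex set.
\<close>

abbreviation graph_connected :: "('v, 'e) pre_digraph \<Rightarrow> bool" where
  "graph_connected \<equiv> Digraph_Component.connected"


section \<open>Functions on the vertex set\<close>

text \<open>
  The space of functions from \<open>verts G\<close> to \<open>F\<close> is represented by extensional functions, so that
  equality of functions is equality on \<open>verts G\<close>.
\<close>

definition vertex_functions :: "('v, 'e) pre_digraph \<Rightarrow> ('v \<Rightarrow> 'f) set" where
  "vertex_functions G = (verts G \<rightarrow>\<^sub>E UNIV)"

definition adj_op :: "('v, 'e) pre_digraph \<Rightarrow> ('v \<Rightarrow> 'f :: field) \<Rightarrow> 'v \<Rightarrow> 'f" where
  "adj_op G f = (\<lambda>v\<in>verts G. \<Sum>u\<in>neighbours G v. f u)"

definition vertex_delta :: "('v, 'e) pre_digraph \<Rightarrow> 'v \<Rightarrow> 'v \<Rightarrow> 'f :: field" where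
  "vertex_delta G v = (\<lambda>u\<in>verts G. if u = v then 1 else 0)"

definition propagator ::
    "('v, 'e) pre_digraph \<Rightarrow> 'f :: field \<Rightarrow> 'v \<Rightarrow> ('v \<Rightarrow> 'f) \<Rightarrow> bool" where
  "propagator G lam v f \<longleftrightarrow>
     f \<in> vertex_functions G \<and>
     (\<lambda>u\<in>verts G. adj_op G f u - lam * f u) = vertex_delta G v"

definition no_propagator_set :: "('v, 'e) pre_digraph \<Rightarrow> 'f :: field \<Rightarrow> 'v set" where
  "no_propagator_set G lam = {v \<in> verts G. \<not> (\<exists>f. propagator G lam v f)}"

text \<open>The following three notions are meant for finite graphs.\<close>

definition adj_eigenfunction ::
    "('v, 'e) pre_digraph \<Rightarrow> 'f :: field \<Rightarrow> ('v \<Rightarrow> 'f) \<Rightarrow> bool" where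
  "adj_eigenfunction D lam f \<longleftrightarrow>
     f \<in> vertex_functions D \<and> (\<exists>w\<in>verts D. f w \<noteq> 0) \<and>
     (\<forall>w\<in>verts D. (\<Sum>u\<in>neighbours D w. f u) = lam * f w)"

definition adj_eigenvalue :: "('v, 'e) pre_digraph \<Rightarrow> 'f :: field \<Rightarrow> bool" where
  "adj_eigenvalue D lam \<longleftrightarrow> (\<exists>f. adj_eigenfunction D lam f)"

definition vertex_support :: "('v, 'e) pre_digraph \<Rightarrow> ('v \<Rightarrow> 'f :: field) \<Rightarrow> 'v set" where
  "vertex_support D f = {w \<in> verts D. f w \<noteq> 0}"


section \<open>Fields\<close>

text \<open>The field \<open>F\<close> is the universe of a type of class \<open>field\<close>.\<close>

definition absolute_value :: "('f :: field \<Rightarrow> real) \<Rightarrow> bool" where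
  "absolute_value a \<longleftrightarrow>
     (\<forall>x. 0 \<le> a x) \<and> (\<forall>x. a x = 0 \<longleftrightarrow> x = 0) \<and>
     (\<forall>x y. a (x * y) = a x * a y) \<and> (\<forall>x y. a (x + y) \<le> a x + a y)"

definition is_subfield :: "'f :: field set \<Rightarrow> bool" where
  "is_subfield K \<longleftrightarrow>
     1 \<in> K \<and> (\<forall>x\<in>K. \<forall>y\<in>K. x - y \<in> K \<and> x * y \<in> K) \<and> (\<forall>x\<in>K. inverse x \<in> K)"

definition prime_subfield :: "'f :: field set" where
  "prime_subfield = is_subfield hull {}"

definition adjoin :: "'f :: field set \<Rightarrow> 'f \<Rightarrow> 'f set" where
  "adjoin K x = is_subfield hull (insert x K)"

definition algebraic_over :: "'f :: field set \<Rightarrow> 'f \<Rightarrow> bool" where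
  "algebraic_over K x \<longleftrightarrow> (\<exists>p. p \<noteq> 0 \<and> (\<forall>i. coeff p i \<in> K) \<and> poly p x = 0)"

end

theory Submission
  imports
    Defs
    "HOL-Library.Function_Algebras"
    "Jordan_Normal_Form.Char_Poly"
begin

text \<open>
  A propagator at \<open>v\<close> solves the linear system \<open>(A - \<lambda>)f = \<delta>\<^sub>v\<close>, with one equation per vertex;
  local finiteness makes every equation finitary. Such a system, however large, is unsolvable
  only if finitely many of its equations already contradict each other
  (\<open>finitary_system_alternative\<close>). Since the right-hand side is \<open>\<delta>\<^sub>v\<close>, a contradiction is a linear
  relation among the rows of \<open>A - \<lambda>\<close> in which the row of \<open>v\<close> occurs. As \<open>A\<close> is symmetric, the
  coefficients of that relation form a function \<open>g\<close> of finite support with \<open>Ag = \<lambda>g\<close> on the whole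
  graph and \<open>g(v) \<noteq> 0\<close>. Once its support is fixed, \<open>g\<close> solves a finite homogeneous system over
  \<open>F\<^sub>0(\<lambda>)\<close>, and elimination shows that it can be chosen with values in \<open>F\<^sub>0(\<lambda>)\<close>
  (\<open>homogeneous_system_descends\<close>).

  The sets \<open>X\<close> and \<open>Y\<close> are the components of \<open>v\<close> in the subgraphs of \<open>\<Gamma>\<close> and \<open>\<Gamma>\<^sup>2\<close> induced by the
  support of \<open>g\<close>. At a vertex of \<open>X\<close>, restricting \<open>g\<close> to \<open>X\<close> drops no nonzero neighbour. A
  vertex and its neighbours are pairwise adjacent in \<open>\<Gamma>\<^sup>2\<close>, so cutting \<open>g\<close> down to \<open>Y\<close> keeps all or
  none of the nonzero values at and around each vertex of \<open>\<Gamma>\<close>; the result is an eigenfunction on the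
  whole graph, and hence on every finite \<open>Z\<close> containing \<open>Y\<close> (\<open>no_propagator_imp_supports\<close>).

  All arithmetic conclusions come from the characteristic polynomial of the adjacency matrix of
  \<open>\<langle>X\<rangle>\<close>, a monic polynomial with integer coefficients. It vanishes at \<open>\<lambda>\<close>, so \<open>\<lambda>\<close> is algebraic, and
  in positive characteristic \<open>F\<^sub>0(\<lambda>)\<close> consists of the finitely many integer combinations of
  \<open>1, \<lambda>, \<dots>, \<lambda>\<^bsup>|X|-1\<^esup>\<close> (\<open>finite_adjoin_integral\<close>). Its complex roots are eigenvalues of a real
  symmetric matrix, hence real, and comparing both sides of the eigenvalue equation at a vertex
  where the eigenfunction has largest modulus bounds them by the degree of that vertex. If the
  bound is the maximal degree and is attained, equality propagates from such a vertex to its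
  neighbours, hence over the connected graph \<open>\<langle>X\<rangle>\<close> (\<open>adj_eigenvalue_degree_bound\<close>); every degree in
  \<open>\<langle>X\<rangle>\<close> then equals the maximal degree in \<open>\<Gamma>\<close>, so no edge leaves \<open>X\<close>.
\<close>


section \<open>Subfields\<close>

lemma subfield_closure:
  assumes "is_subfield K"
  shows subfield_one: "1 \<in> K"
    and subfield_zero: "0 \<in> K"
    and subfield_diff: "\<And>x y. x \<in> K \<Longrightarrow> y \<in> K \<Longrightarrow> x - y \<in> K"
    and subfield_uminus: "\<And>x. x \<in> K \<Longrightarrow> - x \<in> K"
    and subfield_add: "\<And>x y. x \<in> K \<Longrightarrow> y \<in> K \<Longrightarrow> x + y \<in> K"
    and subfield_mult: "\<And>x y. x \<in> K \<Longrightarrow> y \<in> K \<Longrightarrow> x * y \<in> K"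
    and subfield_inverse: "\<And>x. x \<in> K \<Longrightarrow> inverse x \<in> K"
proof -
  show 1: "1 \<in> K" using assms by (simp add: is_subfield_def)
  show d: "x - y \<in> K" if "x \<in> K" "y \<in> K" for x y using assms that by (simp add: is_subfield_def)
  show 0: "0 \<in> K" using d[OF 1 1] by simp
  show m: "- x \<in> K" if "x \<in> K" for x using d[OF 0 that] by simp
  show "x + y \<in> K" if "x \<in> K" "y \<in> K" for x y using d[OF that(1) m[OF that(2)]] by simp
  show "x * y \<in> K" if "x \<in> K" "y \<in> K" for x y using assms that by (simp add: is_subfield_def)
  show "inverse x \<in> K" if "x \<in> K" for x using assms that by (simp add: is_subfield_def)
qed

lemma subfield_sum: "is_subfield K \<Longrightarrow> (\<And>i. i \<in> I \<Longrightarrow> f i \<in> K) \<Longrightarrow> sum f I \<in> K"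
  by (induction I rule: infinite_finite_induct) (auto intro: subfield_zero subfield_add)

lemma is_subfield_hull: "is_subfield (is_subfield hull S)"
  by (rule hull_in) (auto simp: is_subfield_def)

lemma is_subfield_adjoin: "is_subfield (adjoin K x)"
  unfolding adjoin_def by (rule is_subfield_hull)

lemma adjoin_self: "x \<in> adjoin K x"
  unfolding adjoin_def by (rule hull_inc) simp

lemma of_int_in_subfield:
  assumes K: "is_subfield K"
  shows "of_int i \<in> K"
proof -
  have "of_nat n \<in> K" for n
    by (induction n) (auto intro: subfield_zero[OF K] subfield_one[OF K] subfield_add[OF K])
  then show ?thesis
    by (cases i rule: int_cases2) (auto intro: subfield_uminus[OF K])
qed


section \<open>Linear systems\<close>

text \<open>Gaussian elimination of the unknowns other than \<open>v\<close> never leaves \<open>K\<close>, and the solution \<open>x\<close> in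
  the large field survives each elimination. What remains are equations in the unknown \<open>v\<close> alone
  with a nonzero solution; they are trivial, so \<open>1\<close> solves them, and back substitution stays
  in \<open>K\<close>.\<close>

lemma homogeneous_system_descends:
  fixes x :: "'i \<Rightarrow> 'f :: field"
  assumes K: "is_subfield K" and fin: "finite I" and v: "v \<in> I"
    and coeff: "\<And>a i. a \<in> A \<Longrightarrow> i \<in> I \<Longrightarrow> a i \<in> K"
    and sol: "\<And>a. a \<in> A \<Longrightarrow> (\<Sum>i\<in>I. a i * x i) = 0" and xv: "x v \<noteq> 0"
  shows "\<exists>y. (\<forall>i\<in>I. y i \<in> K) \<and> y v \<noteq> 0 \<and> (\<forall>a\<in>A. (\<Sum>i\<in>I. a i * y i) = 0)"
proof -
  have "\<exists>y. (\<forall>i\<in>insert v J. y i \<in> K) \<and> y v \<noteq> 0 \<and> (\<forall>a\<in>A. (\<Sum>i\<in>insert v J. a i * y i) = 0)"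
    if "finite J" "v \<notin> J" "\<And>a i. a \<in> A \<Longrightarrow> i \<in> insert v J \<Longrightarrow> a i \<in> K"
      "\<And>a. a \<in> A \<Longrightarrow> (\<Sum>i\<in>insert v J. a i * x i) = 0" for J and A :: "('i \<Rightarrow> 'f) set"
    using that
  proof (induction J arbitrary: A rule: finite_induct)
    case empty
    have "\<forall>a\<in>A. a v = 0" using empty.prems(3) xv by simp
    then show ?case using subfield_one[OF K] by (intro exI[of _ "\<lambda>_. 1"]) simp
  next
    case (insert w J)
    let ?I = "insert v J"
    have fI: "finite ?I" and wI: "w \<notin> ?I" and I: "insert v (insert w J) = insert w ?I"
      using insert by auto
    have sum_I: "(\<Sum>i\<in>insert w ?I. f i) = f w + (\<Sum>i\<in>?I. f i)" for f :: "'i \<Rightarrow> 'f"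
      using fI wI by (rule sum.insert)
    show ?case
    proof (cases "\<exists>a\<in>A. a w \<noteq> 0")
      case False
      have "\<exists>y. (\<forall>i\<in>?I. y i \<in> K) \<and> y v \<noteq> 0 \<and> (\<forall>a\<in>A. (\<Sum>i\<in>?I. a i * y i) = 0)"
      proof (rule insert.IH)
        show "(\<Sum>i\<in>?I. a i * x i) = 0" if "a \<in> A" for a
        proof -
          have "a w = 0" using False that by blast
          then show ?thesis using insert.prems(3)[OF that] unfolding I sum_I by simp
        qed
      qed (use insert.prems in auto)
      then obtain y where y: "\<And>i. i \<in> ?I \<Longrightarrow> y i \<in> K" "y v \<noteq> 0"
        "\<And>a. a \<in> A \<Longrightarrow> (\<Sum>i\<in>?I. a i * y i) = 0" by blast
      have "(\<Sum>i\<in>insert w ?I. a i * (y(w := 0)) i) = 0" if "a \<in> A" for a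
      proof -
        have "(\<Sum>i\<in>?I. a i * (y(w := 0)) i) = (\<Sum>i\<in>?I. a i * y i)"
          using wI by (intro sum.cong) auto
        then show ?thesis unfolding sum_I using y(3)[OF that] by simp
      qed
      moreover have "\<forall>i\<in>insert w ?I. (y(w := 0)) i \<in> K"
        using y(1) subfield_zero[OF K] by simp
      moreover have "(y(w := 0)) v \<noteq> 0" using y(2) wI by auto
      ultimately show ?thesis unfolding I by blast
    next
      case True
      then obtain a where a: "a \<in> A" "a w \<noteq> 0" by blast
      \<comment> \<open>\<open>e b\<close> is the equation \<open>b\<close> with the unknown \<open>w\<close> eliminated by means of \<open>a\<close>\<close>
      define e where "e = (\<lambda>b i. b i - b w * inverse (a w) * a i)"
      have "\<exists>y. (\<forall>i\<in>?I. y i \<in> K) \<and> y v \<noteq> 0 \<and> (\<forall>b\<in>e ` A. (\<Sum>i\<in>?I. b i * y i) = 0)"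
      proof (rule insert.IH)
        show "v \<notin> J" using insert.prems by auto
        show "b i \<in> K" if "b \<in> e ` A" "i \<in> ?I" for b i
          using that a insert.prems(2)
          by (auto simp: e_def intro!: subfield_diff[OF K] subfield_mult[OF K] subfield_inverse[OF K])
        show "(\<Sum>i\<in>?I. b i * x i) = 0" if b: "b \<in> e ` A" for b
        proof -
          obtain c where c: "c \<in> A" "b = e c" using b by blast
          have "(\<Sum>i\<in>?I. b i * x i) = (\<Sum>i\<in>?I. c i * x i) - c w * inverse (a w) * (\<Sum>i\<in>?I. a i * x i)"
            by (simp only: c(2) e_def left_diff_distrib sum_subtractf sum_distrib_left mult.assoc)
          also have "(\<Sum>i\<in>?I. c i * x i) = - (c w * x w)"
            using insert.prems(3)[OF c(1)] unfolding I sum_I by (simp add: eq_neg_iff_add_eq_0 add.commute)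
          also have "(\<Sum>i\<in>?I. a i * x i) = - (a w * x w)"
            using insert.prems(3)[OF a(1)] unfolding I sum_I by (simp add: eq_neg_iff_add_eq_0 add.commute)
          finally show ?thesis using a(2) by simp
        qed
      qed
      then obtain y where y: "\<And>i. i \<in> ?I \<Longrightarrow> y i \<in> K" "y v \<noteq> 0"
        "\<And>b. b \<in> A \<Longrightarrow> (\<Sum>i\<in>?I. e b i * y i) = 0" by blast
      define s where "s = (\<Sum>i\<in>?I. a i * y i)"
      define y' where "y' = y(w := - inverse (a w) * s)"
      have sK: "s \<in> K"
        unfolding s_def using y(1) a(1) insert.prems(2)
        by (intro subfield_sum[OF K] subfield_mult[OF K]) auto
      have y'I: "(\<Sum>i\<in>?I. b i * y' i) = (\<Sum>i\<in>?I. b i * y i)" for b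
        using wI by (intro sum.cong) (auto simp: y'_def)
      have "(\<Sum>i\<in>insert w ?I. b i * y' i) = 0" if "b \<in> A" for b
      proof -
        have "0 = (\<Sum>i\<in>?I. e b i * y i)" using y(3)[OF that] by simp
        also have "\<dots> = (\<Sum>i\<in>?I. b i * y i) - b w * inverse (a w) * s"
          by (simp only: s_def e_def left_diff_distrib sum_subtractf sum_distrib_left mult.assoc)
        finally show ?thesis unfolding sum_I y'I by (simp add: y'_def)
      qed
      moreover have "\<forall>i\<in>insert w ?I. y' i \<in> K"
        using y(1) sK a insert.prems(2)
        by (auto simp: y'_def intro!: subfield_uminus[OF K] subfield_mult[OF K] subfield_inverse[OF K])
      moreover have "y' v \<noteq> 0" using y(2) wI by (auto simp: y'_def)
      ultimately show ?thesis unfolding I by blast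
    qed
  qed
  from this[of "I - {v}" A] show ?thesis
    using fin v coeff sol by (simp add: insert_absorb)
qed

lemma sum_fun_apply: "(\<Sum>i\<in>I. f i) x = (\<Sum>i\<in>I. f i x)"
  for f :: "'i \<Rightarrow> 'a \<Rightarrow> 'b :: comm_monoid_add"
  by (induction I rule: infinite_finite_induct) auto

text \<open>The rows are vectors of finite support, and solving the system means finding a linear functional
  that is \<open>1\<close> on the row of \<open>v\<close> and \<open>0\<close> on all other rows. It exists by extension of a basis unless
  the row of \<open>v\<close> lies in the span of the others, and then \<open>g\<close> collects the coefficients of such a
  dependency.\<close>

lemma finitary_system_alternative:
  fixes R :: "'u \<Rightarrow> 'v \<Rightarrow> 'f :: field"
  assumes fin: "\<And>u. u \<in> U \<Longrightarrow> finite {w. R u w \<noteq> 0}" and v: "v \<in> U"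
    and unsolvable: "\<not> (\<exists>f. \<forall>u\<in>U. (\<Sum>w | R u w \<noteq> 0. R u w * f w) = (if u = v then 1 else 0))"
  shows "\<exists>g. finite {u. g u \<noteq> 0} \<and> {u. g u \<noteq> 0} \<subseteq> U \<and> g v \<noteq> 0 \<and>
           (\<forall>w. (\<Sum>u | g u \<noteq> 0. g u * R u w) = 0)"
proof -
  define sc where "sc = (\<lambda>(c::'f) (x::'v \<Rightarrow> 'f) w. c * x w)"
  interpret V: vector_space sc
    by unfold_locales (auto simp: sc_def fun_eq_iff algebra_simps)
  interpret F: vector_space "(*) :: 'f \<Rightarrow> 'f \<Rightarrow> 'f"
    by unfold_locales (auto simp: algebra_simps)
  interpret VF: vector_space_pair sc "(*) :: 'f \<Rightarrow> 'f \<Rightarrow> 'f" ..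
  let ?S = "R ` (U - {v})"
  have "R v \<in> V.span ?S"
  proof (rule ccontr)
    assume notin: "R v \<notin> V.span ?S"
    obtain B where B: "B \<subseteq> ?S" "V.independent B" "?S \<subseteq> V.span B"
      using V.maximal_independent_subset by blast
    have "V.span B \<subseteq> V.span ?S" using B(1) by (rule V.span_mono)
    with notin have notB: "R v \<notin> V.span B" by blast
    then have "V.independent (insert (R v) B)" using B(2) by (rule V.independent_insertI)
    from VF.linear_independent_extend[OF this, of "\<lambda>b. if b = R v then 1 else 0"]
    obtain p where p: "Vector_Spaces.linear sc (*) p"
      "\<And>b. b \<in> insert (R v) B \<Longrightarrow> p b = (if b = R v then 1 else 0)" by blast
    interpret p: Vector_Spaces.linear sc "(*)" p by (rule p(1))
    have pB: "p b = 0" if "b \<in> V.span B" for b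
    proof (rule p.eq_0_on_span[OF _ that])
      fix x assume "x \<in> B"
      then show "p x = 0" using p(2)[of x] notB V.span_base[of x B] by auto
    qed
    \<comment> \<open>a functional on vectors of finite support is evaluation against its values on unit vectors\<close>
    define f where "f = (\<lambda>w. p (\<lambda>z. if z = w then 1 else 0))"
    have "(\<Sum>w | R u w \<noteq> 0. R u w * f w) = (if u = v then 1 else 0)" if u: "u \<in> U" for u
    proof -
      have "R u = (\<Sum>w | R u w \<noteq> 0. sc (R u w) (\<lambda>z. if z = w then 1 else 0))"
      proof
        fix z
        show "R u z = (\<Sum>w | R u w \<noteq> 0. sc (R u w) (\<lambda>z. if z = w then 1 else 0)) z"
          using fin[OF u] by (simp add: sum_fun_apply sc_def if_distrib sum.delta cong: if_cong)
      qed
      then have "p (R u) = p (\<Sum>w | R u w \<noteq> 0. sc (R u w) (\<lambda>z. if z = w then 1 else 0))" by simp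
      also have "\<dots> = (\<Sum>w | R u w \<noteq> 0. R u w * f w)"
        by (simp add: p.sum p.scale f_def)
      finally have "(\<Sum>w | R u w \<noteq> 0. R u w * f w) = p (R u)" by simp
      also have "\<dots> = (if u = v then 1 else 0)"
      proof (cases "u = v")
        case True then show ?thesis using p(2)[of "R v"] by simp
      next
        case False
        then have "R u \<in> V.span B" using u B(3) by blast
        then show ?thesis using pB False by simp
      qed
      finally show ?thesis .
    qed
    with unsolvable show False by blast
  qed
  then obtain t r where t: "finite t" "t \<subseteq> ?S" "R v = (\<Sum>a\<in>t. sc (r a) a)"
    unfolding V.span_explicit by blast
  \<comment> \<open>equal rows at distinct indices are possible, so one index per row is selected\<close>
  obtain T where T: "T \<subseteq> U - {v}" "inj_on R T" "t = R ` T"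
    using t(2) by (auto simp: subset_image_inj)
  have finT: "finite T" using t(1) T(2,3) finite_image_iff by blast
  define g where "g = (\<lambda>u. if u = v then 1 else if u \<in> T then - r (R u) else 0)"
  have vT: "v \<notin> T" using T(1) by blast
  have sub: "{u. g u \<noteq> 0} \<subseteq> insert v T" by (auto simp: g_def split: if_splits)
  have "(\<Sum>u | g u \<noteq> 0. g u * R u w) = 0" for w
  proof -
    have "(\<Sum>u | g u \<noteq> 0. g u * R u w) = (\<Sum>u\<in>insert v T. g u * R u w)"
      using sub finT by (intro sum.mono_neutral_left) auto
    also have "\<dots> = R v w + (\<Sum>u\<in>T. - (r (R u) * R u w))"
      using finT vT by (auto simp: g_def intro!: sum.cong)
    also have "R v w = (\<Sum>u\<in>T. r (R u) * R u w)"
      by (subst t(3)) (simp add: T(3) sum.reindex[OF T(2)] sum_fun_apply sc_def)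
    finally show ?thesis by (simp add: sum_negf)
  qed
  moreover have "finite {u. g u \<noteq> 0}" using sub finT finite_subset by blast
  moreover have "{u. g u \<noteq> 0} \<subseteq> U" using sub T(1) v by blast
  ultimately show ?thesis by (intro exI[of _ g]) (simp add: g_def)
qed


section \<open>Neighbours and components\<close>

lemma neighbours_subset_verts: "wf_digraph G \<Longrightarrow> neighbours G v \<subseteq> verts G"
  by (auto simp: neighbours_def dest: wf_digraph.adj_in_verts)

lemma in_neighbours_iff: "u \<in> neighbours G v \<longleftrightarrow> v \<rightarrow>\<^bsub>G\<^esub> u"
  by (simp add: neighbours_def)

lemma induce_dominates_iff: "u \<rightarrow>\<^bsub>G \<restriction> X\<^esub> w \<longleftrightarrow> u \<rightarrow>\<^bsub>G\<^esub> w \<and> u \<in> X \<and> w \<in> X"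
  by (auto simp: arcs_ends_conv)

lemma neighbours_induce: "w \<in> X \<Longrightarrow> neighbours (G \<restriction> X) w = neighbours G w \<inter> X"
  by (auto simp: neighbours_def induce_dominates_iff)

lemma (in sym_digraph) neighbours_sym: "u \<in> neighbours G w \<longleftrightarrow> w \<in> neighbours G u"
  by (auto simp: neighbours_def intro: graph_symmetric)

lemma (in simple_graph) not_self_neighbour: "u \<notin> neighbours G u"
  using no_loops by (auto simp: neighbours_def arcs_ends_conv)

lemma sym_digraph_induce:
  assumes "simple_graph G" "X \<subseteq> verts G"
  shows "sym_digraph (G \<restriction> X)"
proof -
  interpret simple_graph G by fact
  show ?thesis using induced_induce[OF assms(2)] by (rule induced_graph_imp_graph)
qed

lemma sym_connected_iff:
  assumes "sym_digraph H"
  shows "graph_connected H \<longleftrightarrow> verts H \<noteq> {} \<and> (\<forall>u\<in>verts H. \<forall>w\<in>verts H. u \<rightarrow>\<^sup>*\<^bsub>H\<^esub> w)"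
proof -
  interpret sym_digraph H by fact
  show ?thesis
    by (simp add: connected_def strongly_connected_def reachable_mk_symmetric_eq[OF sym_arcs])
qed

text \<open>The component of \<open>v\<close> in \<open>\<langle>W\<rangle>\<close> is used for \<open>\<Gamma>\<close> as well as for \<open>\<Gamma>\<^sup>2\<close>, hence the general symmetric
  digraph.\<close>

lemma component_within:
  fixes H :: "('v, 'e) pre_digraph"
  assumes H: "sym_digraph H" and W: "W \<subseteq> verts H" and v: "v \<in> W"
  defines "C \<equiv> component_verts (H \<restriction> W) v"
  shows component_within_connected: "graph_connected (H \<restriction> C)"
    and component_within_self: "v \<in> C"
    and component_within_subset: "C \<subseteq> W"
    and component_within_closed: "\<And>u w. u \<in> C \<Longrightarrow> w \<in> W \<Longrightarrow> u \<rightarrow>\<^bsub>H\<^esub> w \<Longrightarrow> w \<in> C"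
proof -
  interpret H: sym_digraph H by fact
  interpret HW: sym_digraph "H \<restriction> W"
    using H.induced_induce[OF W] by (rule H.induced_graph_imp_graph)
  show vC: "v \<in> C" using v by (auto simp: C_def component_verts_def)
  show CW: "C \<subseteq> W"
    using HW.reachable_in_verts by (fastforce simp: C_def component_verts_def)
  show "w \<in> C" if "u \<in> C" "w \<in> W" "u \<rightarrow>\<^bsub>H\<^esub> w" for u w
    using that CW HW.reachable_adj_trans[of v u w]
    by (auto simp: C_def component_verts_def induce_dominates_iff)
  interpret HC: sym_digraph "H \<restriction> C"
    using H.induced_induce CW W by (blast intro: H.induced_graph_imp_graph)
  have WC: "(H \<restriction> W) \<restriction> C = H \<restriction> C" using CW by (auto simp: induce_subgraph_def)
  have "v \<rightarrow>\<^sup>*\<^bsub>H \<restriction> C\<^esub> u" if "u \<in> C" for u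
    using HW.induce_reachable_preserves_paths[of v u] that WC
    by (simp add: C_def component_verts_def)
  then have "u \<rightarrow>\<^sup>*\<^bsub>H \<restriction> C\<^esub> w" if "u \<in> C" "w \<in> C" for u w
    using HC.reachable_trans[OF HC.symmetric_reachable'] that by metis
  then show "graph_connected (H \<restriction> C)"
    unfolding sym_connected_iff[OF HC.sym_digraph_axioms] using vC by auto
qed

lemma graph_square_dominates_iff:
  assumes "simple_graph G"
  shows "u \<rightarrow>\<^bsub>graph_square G\<^esub> w \<longleftrightarrow> u \<noteq> w \<and> (u \<rightarrow>\<^bsub>G\<^esub> w \<or> (\<exists>z. u \<rightarrow>\<^bsub>G\<^esub> z \<and> z \<rightarrow>\<^bsub>G\<^esub> w))"
proof -
  interpret simple_graph G by fact
  have "(\<exists>p. apath u p w \<and> length p \<le> 2) \<longleftrightarrow> u \<rightarrow>\<^bsub>G\<^esub> w \<or> (\<exists>z. u \<rightarrow>\<^bsub>G\<^esub> z \<and> z \<rightarrow>\<^bsub>G\<^esub> w)" (is "?L \<longleftrightarrow> ?R")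
    if "u \<noteq> w"
  proof
    assume ?L
    then obtain p where p: "awalk u p w" "length p \<le> 2" by (auto simp: apath_def)
    then consider "p = []" | a where "p = [a]" | a b where "p = [a, b]"
      by (cases p; cases "tl p") auto
    then show ?R
      by cases (use p that in \<open>force simp: awalk_def arcs_ends_conv\<close>)+
  next
    assume R: ?R
    then have uG: "u \<in> verts G" by (auto dest: adj_in_verts)
    show ?L
    proof (cases "u \<rightarrow>\<^bsub>G\<^esub> w")
      case True
      then obtain a where "a \<in> arcs G" "tail G a = u" "head G a = w" by (auto simp: arcs_ends_conv)
      then have "apath u [a] w" using that uG by (auto simp: apath_def awalk_def)
      then show ?thesis by (intro exI[of _ "[a]"]) simp
    next
      case False
      then obtain z where "u \<rightarrow>\<^bsub>G\<^esub> z" "z \<rightarrow>\<^bsub>G\<^esub> w" using R by blast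
      obtain a where a: "a \<in> arcs G" "tail G a = u" "head G a = z"
        using \<open>u \<rightarrow>\<^bsub>G\<^esub> z\<close> by (auto simp: arcs_ends_conv)
      obtain b where b: "b \<in> arcs G" "tail G b = z" "head G b = w"
        using \<open>z \<rightarrow>\<^bsub>G\<^esub> w\<close> by (auto simp: arcs_ends_conv)
      have "u \<noteq> z" "z \<noteq> w" using no_loops[OF a(1)] no_loops[OF b(1)] a b by simp_all
      then have "apath u [a, b] w" using that uG a b by (simp add: apath_def awalk_def)
      then show ?thesis by (intro exI[of _ "[a, b]"]) simp
    qed
  qed
  then show ?thesis by (auto simp: graph_square_def arcs_ends_conv image_iff)
qed

lemma sym_digraph_graph_square:
  assumes "simple_graph G"
  shows "sym_digraph (graph_square G)"
proof
  interpret simple_graph G by fact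
  show "tail (graph_square G) e \<in> verts (graph_square G)" if "e \<in> arcs (graph_square G)" for e
    using that by (auto simp: graph_square_def apath_def)
  show "head (graph_square G) e \<in> verts (graph_square G)" if "e \<in> arcs (graph_square G)" for e
    using that by (auto simp: graph_square_def apath_def)
  show "symmetric (graph_square G)"
    unfolding symmetric_def sym_def graph_square_dominates_iff[OF assms]
    using graph_symmetric by blast
qed


section \<open>Eigenfunctions of finite support\<close>

text \<open>The matrix \<open>A - \<lambda>\<close> is symmetric, so a finite dependency among its rows is the same as an
  eigenfunction of finite support.\<close>

lemma no_propagator_imp_eigenfunction:
  fixes G :: "('v, 'e) pre_digraph" and lam :: "'f :: field"
  assumes G: "simple_graph G" and lf: "locally_finite G" and v: "v \<in> no_propagator_set G lam"
    and K: "is_subfield K" and lamK: "lam \<in> K"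
  shows "\<exists>g. finite {u. g u \<noteq> 0} \<and> {u. g u \<noteq> 0} \<subseteq> verts G \<and> g v \<noteq> 0 \<and> range g \<subseteq> K \<and>
           (\<forall>w. (\<Sum>u | g u \<noteq> 0 \<and> u \<in> neighbours G w. g u) = lam * g w)"
proof -
  interpret simple_graph G by fact
  have vG: "v \<in> verts G" and noprop: "\<not> (\<exists>f. propagator G lam v f)"
    using v by (auto simp: no_propagator_set_def)
  define R where "R = (\<lambda>u w. (if w \<in> neighbours G u then 1 else 0) - (if w = u then lam else 0))"
  have finN: "finite (neighbours G u)" if "u \<in> verts G" for u
    using lf that by (simp add: locally_finite_def)
  have supp: "{w. R u w \<noteq> 0} \<subseteq> insert u (neighbours G u)" for u
    by (auto simp: R_def split: if_splits)
  have R_row: "(\<Sum>w\<in>A. R u w * f w) = (\<Sum>w\<in>A \<inter> neighbours G u. f w) - (if u \<in> A then lam * f u else 0)"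
    if "finite A" for A u and f :: "'v \<Rightarrow> 'f"
  proof -
    have "(\<Sum>w\<in>A. R u w * f w) =
        (\<Sum>w\<in>A. if w \<in> neighbours G u then f w else 0) - (\<Sum>w\<in>A. if w = u then lam * f w else 0)"
      unfolding sum_subtractf[symmetric] by (intro sum.cong) (auto simp: R_def algebra_simps)
    then show ?thesis using that by (simp add: sum.inter_restrict sum.delta)
  qed
  have R_sym: "R u w = R w u" for u w
    using neighbours_sym by (auto simp: R_def)
  have "\<exists>g. finite {u. g u \<noteq> 0} \<and> {u. g u \<noteq> 0} \<subseteq> verts G \<and> g v \<noteq> 0 \<and>
           (\<forall>w. (\<Sum>u | g u \<noteq> 0. g u * R u w) = 0)"
  proof (rule finitary_system_alternative[OF _ vG])
    show "finite {w. R u w \<noteq> 0}" if "u \<in> verts G" for u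
      using supp finN[OF that] by (meson finite_insert finite_subset)
    show "\<not> (\<exists>f. \<forall>u\<in>verts G. (\<Sum>w | R u w \<noteq> 0. R u w * f w) = (if u = v then 1 else 0))"
    proof
      assume "\<exists>f. \<forall>u\<in>verts G. (\<Sum>w | R u w \<noteq> 0. R u w * f w) = (if u = v then 1 else 0)"
      then obtain f where
        f: "\<And>u. u \<in> verts G \<Longrightarrow> (\<Sum>w | R u w \<noteq> 0. R u w * f w) = (if u = v then 1 else 0)" by blast
      have "(\<Sum>w\<in>neighbours G u. f w) - lam * f u = (if u = v then 1 else 0)" if u: "u \<in> verts G" for u
      proof -
        have "(\<Sum>w | R u w \<noteq> 0. R u w * f w) = (\<Sum>w\<in>insert u (neighbours G u). R u w * f w)"
          using supp finN[OF u] by (intro sum.mono_neutral_left) auto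
        also have "\<dots> = (\<Sum>w\<in>neighbours G u. f w) - lam * f u"
          using finN[OF u] not_self_neighbour[of u] by (subst R_row) (auto intro!: sum.cong)
        finally show ?thesis using f[OF u] by simp
      qed
      moreover have "(\<Sum>w\<in>neighbours G u. restrict f (verts G) w) = (\<Sum>w\<in>neighbours G u. f w)" for u
        using neighbours_subset_verts[OF wf_digraph, of u] by (intro sum.cong) auto
      ultimately have "propagator G lam v (restrict f (verts G))"
        unfolding propagator_def vertex_functions_def adj_op_def vertex_delta_def
        by (intro conjI restrict_ext) (simp_all add: restrict_apply' cong: restrict_cong)
      with noprop show False by blast
    qed
  qed
  then obtain x where x: "finite {u. x u \<noteq> 0}" "{u. x u \<noteq> 0} \<subseteq> verts G" "x v \<noteq> 0"
    and sol: "\<And>w. (\<Sum>u | x u \<noteq> 0. x u * R u w) = 0" by blast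
  define W where "W = {u. x u \<noteq> 0}"
  have "\<exists>y. (\<forall>i\<in>W. y i \<in> K) \<and> y v \<noteq> 0 \<and> (\<forall>a\<in>range R. (\<Sum>i\<in>W. a i * y i) = 0)"
  proof (rule homogeneous_system_descends[OF K])
    show "a i \<in> K" if "a \<in> range R" for a i
      using that subfield_zero[OF K] subfield_one[OF K] lamK K
      by (auto simp: R_def is_subfield_def)
    show "(\<Sum>i\<in>W. a i * x i) = 0" if a: "a \<in> range R" for a
    proof -
      obtain w where "a = R w" using a by blast
      then show ?thesis using sol[of w] R_sym[of _ w] by (simp add: W_def mult.commute)
    qed
  qed (use x in \<open>auto simp: W_def\<close>)
  then obtain y where y: "\<And>i. i \<in> W \<Longrightarrow> y i \<in> K" "y v \<noteq> 0" "\<And>w. (\<Sum>i\<in>W. R w i * y i) = 0"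
    by blast
  define g where "g = (\<lambda>u. if u \<in> W then y u else 0)"
  have finW: "finite W" using x(1) by (simp add: W_def)
  have gW: "{u. g u \<noteq> 0} \<subseteq> W" by (auto simp: g_def)
  have "(\<Sum>u | g u \<noteq> 0 \<and> u \<in> neighbours G w. g u) = lam * g w" for w
  proof -
    have "0 = (\<Sum>i\<in>W. R w i * g i)"
      using y(3)[of w] by (simp add: g_def cong: sum.cong)
    also have "\<dots> = (\<Sum>u\<in>W \<inter> neighbours G w. g u) - lam * g w"
      by (simp add: R_row[OF finW] g_def)
    also have "(\<Sum>u\<in>W \<inter> neighbours G w. g u) = (\<Sum>u | g u \<noteq> 0 \<and> u \<in> neighbours G w. g u)"
      using gW finW by (intro sum.mono_neutral_right) auto
    finally show ?thesis by simp
  qed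
  moreover have "finite {u. g u \<noteq> 0}" using gW finW finite_subset by blast
  moreover have "{u. g u \<noteq> 0} \<subseteq> verts G" using gW x(2) by (auto simp: W_def)
  moreover have "g v \<noteq> 0" using x(3) y(2) by (simp add: g_def W_def)
  moreover have "range g \<subseteq> K" using y(1) subfield_zero[OF K] by (auto simp: g_def)
  ultimately show ?thesis by blast
qed

lemma eigenfunction_on_induced:
  assumes K: "is_subfield K" and gK: "range g \<subseteq> K"
    and YZ: "Y \<subseteq> Z" and Y: "Y \<noteq> {}" "\<And>u. u \<in> Y \<Longrightarrow> g u \<noteq> 0" and finZ: "finite Z"
    and eq: "\<And>w. w \<in> Z \<Longrightarrow> (\<Sum>u\<in>neighbours G w \<inter> Y. g u) = lam * (if w \<in> Y then g w else 0)"
  shows "\<exists>f. adj_eigenfunction (G \<restriction> Z) lam f \<and> f \<in> Z \<rightarrow>\<^sub>E K \<and> vertex_support (G \<restriction> Z) f = Y"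
proof -
  define f where "f = (\<lambda>u\<in>Z. if u \<in> Y then g u else 0)"
  have "(\<Sum>u\<in>neighbours (G \<restriction> Z) w. f u) = lam * f w" if w: "w \<in> Z" for w
  proof -
    have "(\<Sum>u\<in>neighbours (G \<restriction> Z) w. f u) = (\<Sum>u\<in>neighbours G w \<inter> Y. g u)"
      unfolding neighbours_induce[OF w] using finZ YZ
      by (intro sum.mono_neutral_cong_right) (auto simp: f_def)
    then show ?thesis using eq[OF w] w by (simp add: f_def)
  qed
  moreover have "\<exists>w\<in>Z. f w \<noteq> 0" using Y YZ by (auto simp: f_def)
  moreover have "f \<in> Z \<rightarrow>\<^sub>E K" using gK subfield_zero[OF K] by (auto simp: f_def image_subset_iff)
  moreover have "vertex_support (G \<restriction> Z) f = Y"
    using Y YZ by (auto simp: f_def vertex_support_def split: if_splits)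
  ultimately show ?thesis
    by (intro exI[of _ f]) (auto simp: adj_eigenfunction_def vertex_functions_def f_def)
qed

text \<open>For \<open>X\<close> the eigenvalue equation is only needed at vertices of \<open>X\<close>. For \<open>Y\<close> it is needed at
  every vertex \<open>w\<close> of a set \<open>Z\<close> that is not known in advance. This is where \<open>\<Gamma>\<^sup>2\<close> enters: if one
  neighbour of \<open>w\<close> lies in \<open>Y\<close>, then so do all neighbours of \<open>w\<close> in the support and, if it is
  in the support, \<open>w\<close> itself.\<close>

lemma no_propagator_imp_supports:
  fixes G :: "('v, 'e) pre_digraph" and lam :: "'f :: field"
  assumes G: "simple_graph G" and lf: "locally_finite G" and v: "v \<in> no_propagator_set G lam"
    and K: "is_subfield K" and lamK: "lam \<in> K"
  obtains X Y where "finite X" "X \<subseteq> verts G" "v \<in> X" "graph_connected (G \<restriction> X)"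
    "\<exists>f. adj_eigenfunction (G \<restriction> X) lam f \<and> f \<in> X \<rightarrow>\<^sub>E K \<and> vertex_support (G \<restriction> X) f = X"
    "finite Y" "Y \<subseteq> verts G" "X \<subseteq> Y" "graph_connected (graph_square G \<restriction> Y)"
    "\<forall>Z. finite Z \<and> Y \<subseteq> Z \<longrightarrow>
       (\<exists>f. adj_eigenfunction (G \<restriction> Z) lam f \<and> f \<in> Z \<rightarrow>\<^sub>E K \<and> vertex_support (G \<restriction> Z) f = Y)"
proof -
  interpret simple_graph G by fact
  obtain g where g: "finite {u. g u \<noteq> 0}" "{u. g u \<noteq> 0} \<subseteq> verts G" "g v \<noteq> 0" "range g \<subseteq> K"
    and eig: "\<And>w. (\<Sum>u | g u \<noteq> 0 \<and> u \<in> neighbours G w. g u) = lam * g w"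
    using no_propagator_imp_eigenfunction[OF assms] by blast
  define W where "W = {u. g u \<noteq> 0}"
  have W: "finite W" "W \<subseteq> verts G" "v \<in> W" using g by (auto simp: W_def)
  have eigW: "(\<Sum>u\<in>neighbours G w \<inter> W. g u) = lam * g w" for w
    using eig[of w] by (simp add: W_def Int_def conj_commute)
  let ?S = "graph_square G"
  have S: "sym_digraph ?S" using G by (rule sym_digraph_graph_square)
  have SW: "W \<subseteq> verts ?S" using W(2) by (simp add: graph_square_def)
  define X where "X = component_verts (G \<restriction> W) v"
  define Y where "Y = component_verts (?S \<restriction> W) v"
  note X = component_within[OF sym_digraph_axioms W(2,3), folded X_def]
  note Y = component_within[OF S SW W(3), folded Y_def]
  note square = graph_square_dominates_iff[OF G]
  have XY: "X \<subseteq> Y"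
  proof
    fix u assume "u \<in> X"
    interpret GW: wf_digraph "G \<restriction> W" by (rule wellformed_induce_subgraph)
    from \<open>u \<in> X\<close> have "v \<rightarrow>\<^sup>*\<^bsub>G \<restriction> W\<^esub> u" by (simp add: X_def component_verts_def)
    then show "u \<in> Y"
    proof (induction rule: GW.reachable_induct)
      case base show ?case by (rule Y(2))
    next
      case (step u w)
      then have "u \<rightarrow>\<^bsub>G\<^esub> w" "w \<in> W" by (auto simp: induce_dominates_iff)
      then show ?case using Y(4)[OF step.IH] square step.IH by (cases "u = w") auto
    qed
  qed
  have eigX: "(\<Sum>u\<in>neighbours G w \<inter> X. g u) = lam * (if w \<in> X then g w else 0)" if "w \<in> X" for w
  proof -
    have "neighbours G w \<inter> X = neighbours G w \<inter> W"
      using X(3) X(4)[OF that] by (auto simp: in_neighbours_iff)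
    then show ?thesis using eigW[of w] that by simp
  qed
  have eigY: "(\<Sum>u\<in>neighbours G w \<inter> Y. g u) = lam * (if w \<in> Y then g w else 0)" for w
  proof (cases "neighbours G w \<inter> Y = {}")
    case True
    have "g w = 0 \<or> lam = 0" if "w \<in> Y"
    proof -
      have "neighbours G w \<inter> W = {}"
      proof (rule ccontr)
        assume "neighbours G w \<inter> W \<noteq> {}"
        then obtain u where u: "w \<rightarrow>\<^bsub>G\<^esub> u" "u \<in> W" by (auto simp: in_neighbours_iff)
        then have "w \<noteq> u" using not_self_neighbour[of u] by (auto simp: in_neighbours_iff)
        then have "u \<in> Y" using Y(4)[OF that u(2)] u(1) square by blast
        with True u(1) show False by (auto simp: in_neighbours_iff)
      qed
      then show ?thesis using eigW[of w] by auto
    qed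
    then show ?thesis using True by auto
  next
    case False
    then obtain y where y: "y \<in> Y" "w \<rightarrow>\<^bsub>G\<^esub> y" by (auto simp: in_neighbours_iff)
    then have yw: "y \<rightarrow>\<^bsub>G\<^esub> w" by (blast intro: graph_symmetric)
    have "neighbours G w \<inter> W \<subseteq> Y"
    proof
      fix u assume u: "u \<in> neighbours G w \<inter> W"
      then show "u \<in> Y"
        using Y(4)[OF y(1), of u] y(1) yw square[of y u] by (cases "u = y") (auto simp: in_neighbours_iff)
    qed
    then have "neighbours G w \<inter> Y = neighbours G w \<inter> W" using Y(3) by blast
    moreover have "w \<in> Y" if "g w \<noteq> 0"
    proof -
      have "y \<noteq> w" using yw not_self_neighbour[of w] by (auto simp: in_neighbours_iff)
      then show ?thesis using Y(4)[OF y(1), of w] yw square that by (auto simp: W_def)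
    qed
    ultimately show ?thesis using eigW[of w] by auto
  qed
  have nz: "g u \<noteq> 0" if "u \<in> Y" for u using that Y(3) by (auto simp: W_def)
  show thesis
  proof (rule that)
    show "\<exists>f. adj_eigenfunction (G \<restriction> X) lam f \<and> f \<in> X \<rightarrow>\<^sub>E K \<and> vertex_support (G \<restriction> X) f = X"
      using X(2,3) XY nz W(1) by (intro eigenfunction_on_induced[OF K g(4)] eigX) (auto intro: finite_subset)
    show "\<forall>Z. finite Z \<and> Y \<subseteq> Z \<longrightarrow>
       (\<exists>f. adj_eigenfunction (G \<restriction> Z) lam f \<and> f \<in> Z \<rightarrow>\<^sub>E K \<and> vertex_support (G \<restriction> Z) f = Y)"
      using Y(2) nz by (intro allI impI eigenfunction_on_induced[OF K g(4)] eigY) auto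
  qed (use X Y XY W in \<open>auto intro: finite_subset\<close>)
qed


section \<open>Eigenvalues as roots of monic integer polynomials\<close>

text \<open>The type of the entries is left open so that one integer polynomial can be compared with
  eigenvalues in \<open>F\<close> and in the complex numbers.\<close>

definition adjacency_mat :: "('v, 'e) pre_digraph \<Rightarrow> 'v list \<Rightarrow> 'a :: {zero, one} mat" where
  "adjacency_mat D xs = mat (length xs) (length xs) (\<lambda>(i, j). if xs ! i \<rightarrow>\<^bsub>D\<^esub> xs ! j then 1 else 0)"

lemma adjacency_mat_mult_vec:
  fixes f :: "'v \<Rightarrow> 'f :: field"
  assumes D: "wf_digraph D" and xs: "distinct xs" "set xs = verts D" and i: "i < length xs"
  shows "(adjacency_mat D xs *\<^sub>v vec (length xs) (\<lambda>j. f (xs ! j))) $ i = (\<Sum>u\<in>neighbours D (xs ! i). f u)"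
proof -
  have "(adjacency_mat D xs *\<^sub>v vec (length xs) (\<lambda>j. f (xs ! j))) $ i =
      (\<Sum>j<length xs. if xs ! i \<rightarrow>\<^bsub>D\<^esub> xs ! j then f (xs ! j) else 0)"
    using i by (auto simp: adjacency_mat_def scalar_prod_def lessThan_atLeast0 intro!: sum.cong)
  also have "\<dots> = (\<Sum>u\<in>verts D. if xs ! i \<rightarrow>\<^bsub>D\<^esub> u then f u else 0)"
    using sum.reindex_bij_betw[OF bij_betw_nth[OF xs(1) refl refl],
        of "\<lambda>u. if xs ! i \<rightarrow>\<^bsub>D\<^esub> u then f u else 0"] xs(2) by (simp only:)
  also have "\<dots> = (\<Sum>u\<in>neighbours D (xs ! i). f u)"
    using neighbours_subset_verts[OF D] xs(2)[symmetric]
    by (intro sum.mono_neutral_cong_right) (auto simp: in_neighbours_iff)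
  finally show ?thesis .
qed

lemma adj_eigenvalue_iff_eigenvalue:
  fixes lam :: "'f :: field"
  assumes D: "wf_digraph D" and xs: "distinct xs" "set xs = verts D"
  shows "adj_eigenvalue D lam \<longleftrightarrow> eigenvalue (adjacency_mat D xs) lam"
proof
  let ?n = "length xs" and ?A = "adjacency_mat D xs :: 'f mat"
  have A: "?A \<in> carrier_mat ?n ?n" by (simp add: adjacency_mat_def)
  have nth: "u \<in> verts D \<longleftrightarrow> (\<exists>i<?n. u = xs ! i)" for u
    unfolding xs(2)[symmetric] in_set_conv_nth by blast
  {
    assume "adj_eigenvalue D lam"
    then obtain f where f: "\<exists>w\<in>verts D. f w \<noteq> 0"
      "\<And>w. w \<in> verts D \<Longrightarrow> (\<Sum>u\<in>neighbours D w. f u) = lam * f w"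
      by (auto simp: adj_eigenvalue_def adj_eigenfunction_def)
    define x where "x = vec ?n (\<lambda>j. f (xs ! j))"
    have "x \<noteq> 0\<^sub>v ?n" using f(1) unfolding Bex_def nth by (auto simp: x_def vec_eq_iff)
    moreover have "?A *\<^sub>v x = lam \<cdot>\<^sub>v x"
    proof (rule eq_vecI)
      show "dim_vec (?A *\<^sub>v x) = dim_vec (lam \<cdot>\<^sub>v x)" by (simp add: adjacency_mat_def x_def)
      show "(?A *\<^sub>v x) $ i = (lam \<cdot>\<^sub>v x) $ i" if "i < dim_vec (lam \<cdot>\<^sub>v x)" for i
      proof -
        have i: "i < ?n" using that by (simp add: x_def)
        then have "xs ! i \<in> verts D" using nth by blast
        then show ?thesis
          unfolding x_def adjacency_mat_mult_vec[OF D xs i] using f(2) i by simp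
      qed
    qed
    ultimately show "eigenvalue ?A lam"
      using A unfolding eigenvalue_def eigenvector_def by (intro exI[of _ x]) (auto simp: x_def)
  next
    assume "eigenvalue ?A lam"
    then obtain x where x: "x \<in> carrier_vec ?n" "x \<noteq> 0\<^sub>v ?n" "?A *\<^sub>v x = lam \<cdot>\<^sub>v x"
      using A by (auto simp: eigenvalue_def eigenvector_def)
    define ix where "ix = the_inv_into {..<?n} ((!) xs)"
    have inj: "inj_on ((!) xs) {..<?n}" using xs(1) by (simp add: inj_on_nth)
    have ix: "ix (xs ! i) = i" if "i < ?n" for i
      unfolding ix_def using inj that by (simp add: the_inv_into_f_f)
    define f where "f = (\<lambda>u\<in>verts D. x $ ix u)"
    have f_nth: "f (xs ! i) = x $ i" if "i < ?n" for i
      using that nth ix by (auto simp: f_def)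
    have vec_f: "vec ?n (\<lambda>j. f (xs ! j)) = x" using x(1) f_nth by (intro eq_vecI) auto
    have "(\<Sum>u\<in>neighbours D w. f u) = lam * f w" if w: "w \<in> verts D" for w
    proof -
      obtain i where i: "i < ?n" "w = xs ! i" using w nth by blast
      show ?thesis
        using adjacency_mat_mult_vec[OF D xs i(1), of f] x(1,3) i by (simp add: vec_f f_nth)
    qed
    moreover have "\<exists>w\<in>verts D. f w \<noteq> 0"
    proof -
      obtain i where i: "i < ?n" "x $ i \<noteq> 0"
        using x(1,2) by (metis eq_vecI carrier_vecD dim_vec index_zero_vec)
      then show ?thesis using nth[of "xs ! i"] f_nth[of i] by (intro bexI[of _ "xs ! i"]) auto
    qed
    ultimately show "adj_eigenvalue D lam"
      unfolding adj_eigenvalue_def adj_eigenfunction_def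
      by (intro exI[of _ f]) (auto simp: vertex_functions_def f_def)
  }
qed

lemma root_char_poly_iff_adj_eigenvalue:
  fixes lam :: "'f :: field"
  assumes D: "wf_digraph D" and xs: "distinct xs" "set xs = verts D"
  shows "poly (map_poly of_int (char_poly (adjacency_mat D xs :: int mat))) lam = 0 \<longleftrightarrow> adj_eigenvalue D lam"
proof -
  have "map_poly of_int (char_poly (adjacency_mat D xs :: int mat)) = char_poly (map_mat of_int (adjacency_mat D xs) :: 'f mat)"
    by (rule of_int_hom.char_poly_hom[symmetric, of _ "length xs"]) (simp add: adjacency_mat_def)
  also have "map_mat of_int (adjacency_mat D xs :: int mat) = (adjacency_mat D xs :: 'f mat)"
    by (auto simp: adjacency_mat_def)
  finally show ?thesis
    using eigenvalue_root_char_poly[of "adjacency_mat D xs :: 'f mat" "length xs"]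
    by (simp add: adj_eigenvalue_iff_eigenvalue[OF assms] adjacency_mat_def)
qed

lemma monic_char_poly_adjacency_mat:
  assumes "distinct xs"
  shows "lead_coeff (char_poly (adjacency_mat D xs :: int mat)) = 1"
    and "degree (char_poly (adjacency_mat D xs :: int mat)) = card (set xs)"
  using degree_monic_char_poly[of "adjacency_mat D xs :: int mat" "length xs"] assms
  by (auto simp: adjacency_mat_def distinct_card)


section \<open>Algebraic integers and finite fields\<close>

text \<open>Multiplication by a nonzero element is injective, hence onto by finiteness, so \<open>1\<close> is a
  multiple of that element.\<close>

lemma finite_subring_is_subfield:
  fixes R :: "'f :: field set"
  assumes fin: "finite R" and one: "1 \<in> R"
    and closed: "\<And>x y. x \<in> R \<Longrightarrow> y \<in> R \<Longrightarrow> x - y \<in> R" "\<And>x y. x \<in> R \<Longrightarrow> y \<in> R \<Longrightarrow> x * y \<in> R"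
  shows "is_subfield R"
proof -
  have "inverse x \<in> R" if x: "x \<in> R" for x
  proof (cases "x = 0")
    case False
    have "inj_on ((*) x) R" using False by (auto intro: inj_onI)
    moreover have "(*) x ` R \<subseteq> R" using closed(2) x by auto
    ultimately have "(*) x ` R = R" using fin endo_inj_surj by blast
    then obtain y where y: "y \<in> R" "x * y = 1" using one by (metis imageE)
    then have "inverse x = y" using inverse_unique by blast
    with y(1) show ?thesis by simp
  qed (use x in simp)
  then show ?thesis using one closed by (auto simp: is_subfield_def)
qed

lemma integral_imp_algebraic:
  fixes lam :: "'f :: field" and p :: "int poly"
  assumes "lead_coeff p = 1" "poly (map_poly of_int p) lam = 0"
  shows "algebraic_over prime_subfield lam"
proof -
  have K: "is_subfield (prime_subfield :: 'f set)"
    unfolding prime_subfield_def by (rule is_subfield_hull)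
  have "coeff (map_poly of_int p) (degree p) = (1 :: 'f)" using assms(1) by (simp add: coeff_map_poly)
  then have "map_poly of_int p \<noteq> (0 :: 'f poly)" by (metis coeff_0 zero_neq_one)
  then show ?thesis
    unfolding algebraic_over_def using assms(2) of_int_in_subfield[OF K]
    by (intro exI[of _ "map_poly of_int p"]) (simp add: coeff_map_poly)
qed

text \<open>The relation given by the monic polynomial rewrites \<open>lam ^ degree p\<close> in terms of lower powers;
  the induction is Horner's scheme with this reduction after each multiplication by \<open>lam\<close>.\<close>

lemma integral_element_span:
  fixes lam :: "'f :: field" and p q :: "int poly"
  assumes monic: "lead_coeff p = 1" and root: "poly (map_poly of_int p) lam = 0"
  shows "\<exists>c :: nat \<Rightarrow> int. poly (map_poly of_int q) lam = (\<Sum>i<degree p. of_int (c i) * lam ^ i)"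
proof (induction q rule: pCons_induct)
  case 0
  show ?case by (intro exI[of _ "\<lambda>_. 0"]) simp
next
  case (pCons a q)
  then obtain c :: "nat \<Rightarrow> int"
    where c: "poly (map_poly of_int q) lam = (\<Sum>i<degree p. of_int (c i) * lam ^ i)" by blast
  show ?case
  proof (cases "degree p")
    case 0
    then obtain b where "p = [:b:]" by (elim degree_eq_zeroE)
    then show ?thesis using root monic by simp
  next
    case (Suc m)
    have "degree (map_poly of_int p :: 'f poly) = degree p"
      using monic by (intro antisym degree_map_poly_le le_degree) (simp add: coeff_map_poly)
    then have "0 = (\<Sum>i\<le>degree p. of_int (coeff p i) * lam ^ i)"
      using root by (simp add: poly_altdef coeff_map_poly)
    also have "\<dots> = (\<Sum>i<degree p. of_int (coeff p i) * lam ^ i) + lam ^ degree p"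
      using monic by (simp add: lessThan_Suc_atMost[symmetric])
    finally have "lam ^ degree p = - (\<Sum>i<degree p. of_int (coeff p i) * lam ^ i)"
      by (simp add: eq_neg_iff_add_eq_0 add.commute)
    then have lam_n: "lam ^ Suc m = - (\<Sum>i<Suc m. of_int (coeff p i) * lam ^ i)"
      by (simp only: Suc)
    define c' where "c' = (\<lambda>i. (if i = 0 then a else c (i - 1)) - c m * coeff p i)"
    have "poly (map_poly of_int (pCons a q)) lam = of_int a + lam * (\<Sum>i<Suc m. of_int (c i) * lam ^ i)"
      using c unfolding Suc by (simp only: of_int_hom.map_poly_pCons_hom poly_pCons)
    also have "lam * (\<Sum>i<Suc m. of_int (c i) * lam ^ i) =
        (\<Sum>i<m. of_int (c i) * lam ^ Suc i) + of_int (c m) * lam ^ Suc m"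
      by (simp only: sum.lessThan_Suc distrib_left sum_distrib_left power_Suc mult.left_commute)
    also have "of_int (c m) * lam ^ Suc m = - (\<Sum>i<Suc m. of_int (c m * coeff p i) * lam ^ i)"
      unfolding lam_n by (simp only: mult_minus_right sum_distrib_left of_int_mult mult.assoc)
    also have "of_int a + ((\<Sum>i<m. of_int (c i) * lam ^ Suc i) + - (\<Sum>i<Suc m. of_int (c m * coeff p i) * lam ^ i)) =
        (\<Sum>i<Suc m. of_int (if i = 0 then a else c (i - 1)) * lam ^ i) - (\<Sum>i<Suc m. of_int (c m * coeff p i) * lam ^ i)"
      by (subst (2) sum.lessThan_Suc_shift) simp
    also have "\<dots> = (\<Sum>i<Suc m. of_int (c' i) * lam ^ i)"
      by (simp only: sum_subtractf[symmetric] left_diff_distrib[symmetric] of_int_diff[symmetric] c'_def)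
    finally show ?thesis unfolding Suc by (intro exI)
  qed
qed

text \<open>The ring \<open>\<int>[lam]\<close> is a quotient of a finite ring, because integers may be reduced modulo the
  characteristic and powers of \<open>lam\<close> modulo \<open>p\<close>. A finite subring of a field is a subfield, so it
  already contains \<open>F\<^sub>0(lam)\<close>.\<close>

lemma finite_adjoin_integral:
  fixes lam :: "'f :: field" and p :: "int poly"
  assumes char: "CHAR('f) > 0" and monic: "lead_coeff p = 1"
    and root: "poly (map_poly of_int p) lam = 0"
  shows "finite (adjoin prime_subfield lam)"
proof -
  define n where "n = degree p"
  define ev where "ev = (\<lambda>q :: int poly. poly (map_poly of_int q) lam)"
  have ev_simps: "ev (q + r) = ev q + ev r" "ev (q - r) = ev q - ev r" "ev (q * r) = ev q * ev r"
    "ev (pCons a q) = of_int a + lam * ev q" for q r a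
    by (simp_all add: ev_def hom_distribs)
  define S where "S = (\<lambda>c. \<Sum>i<n. of_int (c i) * lam ^ i) ` ({..<n} \<rightarrow>\<^sub>E {0..<int CHAR('f)})"
  have in_S: "(\<Sum>i<n. of_int (c i) * lam ^ i) \<in> S" for c :: "nat \<Rightarrow> int"
  proof -
    have "of_int (c i mod int CHAR('f)) = (of_int (c i) :: 'f)" for i
    proof -
      have "(of_int (c i) :: 'f) = of_int (int CHAR('f) * (c i div int CHAR('f)) + c i mod int CHAR('f))"
        by simp
      also have "\<dots> = of_int (c i mod int CHAR('f))"
        by (simp only: of_int_add of_int_mult of_int_of_nat_eq of_nat_CHAR) simp
      finally show ?thesis by simp
    qed
    then have "(\<Sum>i<n. of_int (c i) * lam ^ i)
        = (\<Sum>i<n. of_int ((\<lambda>i\<in>{..<n}. c i mod int CHAR('f)) i) * lam ^ i)"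
      by (intro sum.cong) auto
    also have "\<dots> \<in> S" unfolding S_def using char by (intro imageI PiE_I) auto
    finally show ?thesis .
  qed
  have "range ev \<subseteq> S"
  proof -
    have "\<exists>c :: nat \<Rightarrow> int. ev q = (\<Sum>i<n. of_int (c i) * lam ^ i)" for q
      unfolding ev_def n_def using monic root by (rule integral_element_span)
    then show ?thesis using in_S by (metis image_subsetI)
  qed
  moreover have "finite S" unfolding S_def by (intro finite_imageI finite_PiE) auto
  ultimately have fin: "finite (range ev)" by (rule finite_subset)
  have sub: "is_subfield (range ev)"
  proof (rule finite_subring_is_subfield[OF fin])
    have "ev 1 = 1" by (simp add: ev_def)
    then show "1 \<in> range ev" by (metis rangeI)
    fix x y assume "x \<in> range ev" "y \<in> range ev"
    then obtain q r where "x = ev q" "y = ev r" by blast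
    then have "x - y = ev (q - r)" "x * y = ev (q * r)" by (simp_all only: ev_simps)
    then show "x - y \<in> range ev" "x * y \<in> range ev" by blast+
  qed
  have "ev [:0, 1:] = lam" by (simp add: ev_def)
  then have lam: "lam \<in> range ev" by (metis rangeI)
  have "prime_subfield \<subseteq> range ev"
    unfolding prime_subfield_def using sub by (intro hull_minimal) simp_all
  then have "adjoin prime_subfield lam \<subseteq> range ev"
    unfolding adjoin_def using sub lam by (intro hull_minimal) simp_all
  then show ?thesis using fin by (rule finite_subset)
qed


section \<open>Eigenvalues over the complex numbers\<close>

text \<open>The Hermitian form \<open>q = f\<^sup>* A f\<close> is real because the adjacency matrix is real and symmetric, and it
  equals \<open>z\<close> times the positive number \<open>s = f\<^sup>* f\<close>.\<close>

lemma complex_adj_eigenvalue_real: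
  fixes z :: complex
  assumes D: "sym_digraph D" and fin: "finite (verts D)" and z: "adj_eigenvalue D z"
  shows "z \<in> \<real>"
proof -
  interpret sym_digraph D by fact
  obtain f where nz: "\<exists>w\<in>verts D. f w \<noteq> 0"
    and f: "\<And>w. w \<in> verts D \<Longrightarrow> (\<Sum>u\<in>neighbours D w. f u) = z * f w"
    using z by (auto simp: adj_eigenvalue_def adj_eigenfunction_def)
  define s where "s = (\<Sum>w\<in>verts D. (cmod (f w))\<^sup>2)"
  define q where "q = (\<Sum>w\<in>verts D. \<Sum>u\<in>verts D. if w \<rightarrow>\<^bsub>D\<^esub> u then cnj (f w) * f u else 0)"
  have "s > 0"
    unfolding s_def using nz fin by (auto intro!: sum_pos2)
  have "q = (\<Sum>w\<in>verts D. cnj (f w) * (\<Sum>u\<in>neighbours D w. f u))"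
    unfolding q_def sum_distrib_left using fin neighbours_subset_verts[OF wf_digraph]
    by (intro sum.cong refl sum.mono_neutral_cong_right) (auto simp: in_neighbours_iff)
  also have "\<dots> = (\<Sum>w\<in>verts D. z * (f w * cnj (f w)))"
    using f by (intro sum.cong) simp_all
  finally have "q = z * of_real s"
    by (simp add: s_def sum_distrib_left complex_norm_square[symmetric] del: of_real_power)
  moreover have "cnj q = q"
  proof -
    have "cnj q = (\<Sum>w\<in>verts D. \<Sum>u\<in>verts D. if u \<rightarrow>\<^bsub>D\<^esub> w then cnj (f u) * f w else 0)"
      unfolding q_def cnj_sum using graph_symmetric by (intro sum.cong refl) auto
    also have "\<dots> = q" unfolding q_def by (rule sum.swap)
    finally show ?thesis .
  qed
  ultimately have "cnj z = z" using \<open>s > 0\<close> by simp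
  then show ?thesis by (simp add: Reals_cnj_iff)
qed

text \<open>In \<open>z f(w) = \<Sum>\<^sub>u f(u)\<close> each of the \<open>deg(w)\<close> summands has norm at most that of \<open>f(w)\<close>; if \<open>z\<close> has norm
  \<open>deg(w)\<close> there is no room for any of them to be smaller.\<close>

lemma max_modulus_vertex:
  fixes f :: "'v \<Rightarrow> 'a :: real_normed_field"
  assumes fin: "finite (neighbours D w)" and eig: "(\<Sum>u\<in>neighbours D w. f u) = z * f w" and nz: "f w \<noteq> 0"
    and max: "\<And>u. u \<in> neighbours D w \<Longrightarrow> norm (f u) \<le> norm (f w)"
  shows "norm z \<le> real (vertex_degree D w)"
    and "norm z = real (vertex_degree D w) \<Longrightarrow> u \<in> neighbours D w \<Longrightarrow> norm (f u) = norm (f w)"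
proof -
  have le: "norm z * norm (f w) \<le> (\<Sum>u\<in>neighbours D w. norm (f u))"
    using norm_sum[of f "neighbours D w"] by (simp add: eig norm_mult)
  also have "\<dots> \<le> real (vertex_degree D w) * norm (f w)"
    unfolding vertex_degree_def using max by (rule sum_bounded_above)
  finally show "norm z \<le> real (vertex_degree D w)" using nz by simp
  assume z: "norm z = real (vertex_degree D w)" and u: "u \<in> neighbours D w"
  have "(\<Sum>u\<in>neighbours D w. norm (f w) - norm (f u)) \<le> 0"
    using le by (simp add: z sum_subtractf vertex_degree_def)
  then have "(\<Sum>u\<in>neighbours D w. norm (f w) - norm (f u)) = 0"
    using max by (intro antisym sum_nonneg) simp_all
  then have "\<forall>u\<in>neighbours D w. norm (f w) - norm (f u) = 0"
    using max by (subst (asm) sum_nonneg_eq_0_iff[OF fin]) simp_all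
  then show "norm (f u) = norm (f w)" using u by simp
qed

text \<open>If the norm of \<open>z\<close> is \<open>d\<close>, then a vertex of maximal modulus has degree \<open>d\<close> and all its
  neighbours have maximal modulus too, so maximality spreads along walks.\<close>

lemma adj_eigenvalue_degree_bound:
  fixes z :: "'a :: real_normed_field"
  assumes D: "sym_digraph D" and fin: "finite (verts D)" and z: "adj_eigenvalue D z"
    and d: "\<And>w. w \<in> verts D \<Longrightarrow> vertex_degree D w \<le> d"
  shows "norm z \<le> real d"
    and "norm z = real d \<Longrightarrow> graph_connected D \<Longrightarrow> w \<in> verts D \<Longrightarrow> vertex_degree D w = d"
proof -
  interpret sym_digraph D by fact
  have N: "neighbours D w \<subseteq> verts D" for w by (rule neighbours_subset_verts[OF wf_digraph])
  have finN: "finite (neighbours D w)" for w using N fin by (rule finite_subset)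
  obtain f where nz: "\<exists>w\<in>verts D. f w \<noteq> 0"
    and f: "\<And>w. w \<in> verts D \<Longrightarrow> (\<Sum>u\<in>neighbours D w. f u) = z * f w"
    using z by (auto simp: adj_eigenvalue_def adj_eigenfunction_def)
  define M where "M = Max ((\<lambda>w. norm (f w)) ` verts D)"
  have ne: "verts D \<noteq> {}" using nz by blast
  have le_M: "norm (f w) \<le> M" if "w \<in> verts D" for w
    unfolding M_def using fin that by (intro Max_ge) auto
  have "M \<in> (\<lambda>w. norm (f w)) ` verts D"
    unfolding M_def using fin ne by (intro Max_in) auto
  then obtain r where r: "r \<in> verts D" "norm (f r) = M" by auto
  have "M > 0" using nz le_M by (metis norm_le_zero_iff not_le order_trans)
  have max: "norm (f u) \<le> norm (f w)" if "norm (f w) = M" "u \<in> neighbours D w" for u w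
    using le_M N that by auto
  have bound: "norm z \<le> real (vertex_degree D w)"
    and attained: "norm z = real (vertex_degree D w) \<Longrightarrow> u \<in> neighbours D w \<Longrightarrow> norm (f u) = M"
    if w: "w \<in> verts D" "norm (f w) = M" for w u
  proof -
    have "f w \<noteq> 0" using w(2) \<open>M > 0\<close> by auto
    note * = max_modulus_vertex[OF finN f[OF w(1)] this max[OF w(2)]]
    show "norm z \<le> real (vertex_degree D w)" by (rule *(1))
    show "norm z = real (vertex_degree D w) \<Longrightarrow> u \<in> neighbours D w \<Longrightarrow> norm (f u) = M"
      using *(2) w(2) by simp
  qed
  show "norm z \<le> real d" using bound[OF r] d[OF r(1)] by linarith
  assume eq: "norm z = real d" and conn: "graph_connected D" and w: "w \<in> verts D"
  have deg: "vertex_degree D u = d" if "u \<in> verts D" "norm (f u) = M" for u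
    using bound[OF that] d[OF that(1)] eq by simp
  have "r \<rightarrow>\<^sup>*\<^bsub>D\<^esub> w" using conn r(1) w by (simp add: sym_connected_iff[OF D])
  then have "norm (f w) = M"
  proof (induction rule: reachable_induct)
    case base show ?case by (rule r(2))
  next
    case (step x y)
    then have x: "x \<in> verts D" by (blast dest: adj_in_verts)
    show ?case
      using attained[OF x step.IH] deg[OF x step.IH] eq step.hyps by (simp add: in_neighbours_iff)
  qed
  then show "vertex_degree D w = d" using deg w by blast
qed

text \<open>When a root has modulus equal to the maximal degree in \<open>\<Gamma>\<close>, every vertex of \<open>X\<close> has that same
  degree inside \<open>\<langle>X\<rangle>\<close>. It has no room for further neighbours in \<open>\<Gamma>\<close>, so \<open>X\<close> is a whole component.\<close>

lemma integral_polynomial_of_eigenvalue: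
  fixes G :: "('v, 'e) pre_digraph" and lam :: "'f :: field"
  assumes G: "simple_graph G" and lf: "locally_finite G"
    and X: "finite X" "X \<subseteq> verts G" "v \<in> X" and conn: "graph_connected (G \<restriction> X)"
    and lam: "adj_eigenvalue (G \<restriction> X) lam"
  shows "\<exists>p :: int poly. lead_coeff p = 1 \<and> degree p = card X \<and>
    poly (map_poly of_int p) lam = 0 \<and>
    (\<forall>z :: complex. poly (map_poly of_int p) z = 0 \<longrightarrow>
       z \<in> \<real> \<and>
       cmod z \<le> real (Max (vertex_degree (G \<restriction> X) ` X)) \<and>
       cmod z \<le> real (Max (vertex_degree G ` X)) \<and>
       (cmod z = real (Max (vertex_degree G ` X)) \<longrightarrow>
          X = component_verts G v \<and> regular_graph (G \<restriction> X)))"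
proof -
  interpret simple_graph G by fact
  let ?D = "G \<restriction> X"
  interpret D: sym_digraph ?D using G X(2) by (rule sym_digraph_induce)
  note D = D.sym_digraph_axioms
  have fin: "finite (verts ?D)" using X(1) by simp
  obtain xs where xs: "distinct xs" "set xs = X" using finite_distinct_list[OF X(1)] by blast
  then have xsD: "set xs = verts ?D" by simp
  define p where "p = char_poly (adjacency_mat ?D xs :: int mat)"
  have root: "poly (map_poly of_int p) x = 0 \<longleftrightarrow> adj_eigenvalue ?D x" for x :: "'k :: field"
    unfolding p_def using D.wf_digraph xs(1) xsD by (rule root_char_poly_iff_adj_eigenvalue)
  have sub: "neighbours ?D w \<subseteq> neighbours G w" and finN: "finite (neighbours G w)" if "w \<in> X" for w
    using that X(2) lf by (auto simp: neighbours_induce locally_finite_def)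
  have deg_le: "vertex_degree ?D w \<le> vertex_degree G w" if "w \<in> X" for w
    unfolding vertex_degree_def using finN sub that by (intro card_mono)
  have deg_D: "vertex_degree ?D w \<le> Max (vertex_degree ?D ` X)" if "w \<in> X" for w
    using X(1) that by simp
  have deg_max: "vertex_degree G w \<le> Max (vertex_degree G ` X)" if "w \<in> X" for w
    using X(1) that by simp
  have deg_G: "vertex_degree ?D w \<le> Max (vertex_degree G ` X)" if "w \<in> X" for w
    using deg_le deg_max that by (meson order_trans)
  have "z \<in> \<real> \<and> cmod z \<le> real (Max (vertex_degree ?D ` X)) \<and> cmod z \<le> real (Max (vertex_degree G ` X)) \<and>
      (cmod z = real (Max (vertex_degree G ` X)) \<longrightarrow> X = component_verts G v \<and> regular_graph ?D)"
    if "poly (map_poly of_int p) z = 0" for z :: complex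
  proof (intro conjI impI)
    have z: "adj_eigenvalue ?D z" using that root by blast
    show "z \<in> \<real>" using D fin z by (rule complex_adj_eigenvalue_real)
    show "cmod z \<le> real (Max (vertex_degree ?D ` X))"
      using adj_eigenvalue_degree_bound(1)[OF D fin z] deg_D by simp
    show "cmod z \<le> real (Max (vertex_degree G ` X))"
      using adj_eigenvalue_degree_bound(1)[OF D fin z] deg_G by simp
    assume eq: "cmod z = real (Max (vertex_degree G ` X))"
    have deg: "vertex_degree ?D w = Max (vertex_degree G ` X)" if "w \<in> X" for w
      using adj_eigenvalue_degree_bound(2)[OF D fin z _ eq conn] deg_G that by simp
    then show "regular_graph ?D" by (auto simp: regular_graph_def)
    have closed: "neighbours G w \<subseteq> X" if "w \<in> X" for w
    proof -
      have "card (neighbours ?D w) = card (neighbours G w)"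
        using deg[OF that] deg_max[OF that] card_mono[OF finN sub, OF that that]
        by (simp add: vertex_degree_def)
      then have "neighbours ?D w = neighbours G w"
        using finN sub that by (intro card_subset_eq)
      then show ?thesis using that by (auto simp: neighbours_induce)
    qed
    show "X = component_verts G v"
    proof (intro equalityI subsetI)
      fix u assume "u \<in> X"
      then have "v \<rightarrow>\<^sup>*\<^bsub>?D\<^esub> u" using conn X(3) by (simp add: sym_connected_iff[OF D])
      then show "u \<in> component_verts G v"
        using X(2) by (auto simp: component_verts_def dest: reachable_induce_subgraphD)
    next
      fix u assume "u \<in> component_verts G v"
      then have "v \<rightarrow>\<^sup>*\<^bsub>G\<^esub> u" by (simp add: component_verts_def)
      then show "u \<in> X"
      proof (induction rule: reachable_induct)
        case base show ?case by (rule X(3))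
      next
        case (step x y)
        then show ?case using closed[of x] by (auto simp: in_neighbours_iff)
      qed
    qed
  qed
  moreover have "lead_coeff p = 1" "degree p = card X"
    using monic_char_poly_adjacency_mat[OF xs(1), of ?D] xs(2) by (simp_all add: p_def)
  moreover have "poly (map_poly of_int p) lam = 0" using lam root by blast
  ultimately show ?thesis by blast
qed

theorem mainTheorem3:
  fixes G :: "('v, 'e) pre_digraph"
    and absv :: "'f :: field \<Rightarrow> real"
    and lam :: 'f
    and v :: 'v
  assumes "simple_graph G"
    and "locally_finite G"
    and "absolute_value absv"
    and "v \<in> no_propagator_set G lam"
  shows
    "(\<exists>X. finite X \<and> X \<subseteq> verts G \<and> v \<in> X \<and> graph_connected (G \<restriction> X) \<and>
        adj_eigenvalue (G \<restriction> X) lam \<and>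
        (\<exists>f. adj_eigenfunction (G \<restriction> X) lam f \<and>
             f \<in> X \<rightarrow>\<^sub>E adjoin prime_subfield lam \<and>
             vertex_support (G \<restriction> X) f = X) \<and>
        (\<exists>Y. finite Y \<and> Y \<subseteq> verts G \<and> X \<subseteq> Y \<and>
           graph_connected (graph_square G \<restriction> Y) \<and>
           (\<forall>Z. finite Z \<and> Z \<subseteq> verts G \<and> Y \<subseteq> Z \<longrightarrow>
              adj_eigenvalue (G \<restriction> Z) lam \<and>
              (\<exists>f. adj_eigenfunction (G \<restriction> Z) lam f \<and>
                   f \<in> Z \<rightarrow>\<^sub>E adjoin prime_subfield lam \<and>
                   vertex_support (G \<restriction> Z) f = Y)))) \<and>
     algebraic_over prime_subfield lam \<and>
     (CHAR('f) > 0 \<longrightarrow> finite (adjoin prime_subfield lam)) \<and>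
     (CHAR('f) = 0 \<longrightarrow>
       (\<forall>X. finite X \<and> X \<subseteq> verts G \<and> v \<in> X \<and> graph_connected (G \<restriction> X) \<and>
          adj_eigenvalue (G \<restriction> X) lam \<and>
          (\<exists>f. adj_eigenfunction (G \<restriction> X) lam f \<and>
               f \<in> X \<rightarrow>\<^sub>E adjoin prime_subfield lam \<and>
               vertex_support (G \<restriction> X) f = X) \<longrightarrow>
        (\<exists>p :: int poly. lead_coeff p = 1 \<and> degree p = card X \<and>
           poly (map_poly of_int p) lam = 0 \<and>
           (\<forall>z :: complex. poly (map_poly of_int p) z = 0 \<longrightarrow>
              z \<in> \<real> \<and>
              cmod z \<le> real (Max (vertex_degree (G \<restriction> X) ` X)) \<and>
              cmod z \<le> real (Max (vertex_degree G ` X)) \<and>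
              (cmod z = real (Max (vertex_degree G ` X)) \<longrightarrow>
                 X = component_verts G v \<and> regular_graph (G \<restriction> X))))))"
proof -
  let ?K = "adjoin prime_subfield lam"
  obtain X Y where X: "finite X" "X \<subseteq> verts G" "v \<in> X" "graph_connected (G \<restriction> X)"
      "\<exists>f. adj_eigenfunction (G \<restriction> X) lam f \<and> f \<in> X \<rightarrow>\<^sub>E ?K \<and> vertex_support (G \<restriction> X) f = X"
    and Y: "finite Y" "Y \<subseteq> verts G" "X \<subseteq> Y" "graph_connected (graph_square G \<restriction> Y)"
    and Z: "\<forall>Z. finite Z \<and> Y \<subseteq> Z \<longrightarrow>
      (\<exists>f. adj_eigenfunction (G \<restriction> Z) lam f \<and> f \<in> Z \<rightarrow>\<^sub>E ?K \<and> vertex_support (G \<restriction> Z) f = Y)"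
    by (rule no_propagator_imp_supports[OF assms(1,2,4) is_subfield_adjoin[of prime_subfield] adjoin_self])
  have lam: "adj_eigenvalue (G \<restriction> X) lam"
    using X(5) unfolding adj_eigenvalue_def by blast
  have lamZ: "adj_eigenvalue (G \<restriction> Z) lam" if "finite Z" "Y \<subseteq> Z" for Z
    using Z[rule_format, OF conjI[OF that]] unfolding adj_eigenvalue_def by blast
  note poly = integral_polynomial_of_eigenvalue[OF assms(1,2)]
  obtain p :: "int poly" where p: "lead_coeff p = 1" "poly (map_poly of_int p) lam = 0"
    using poly[OF X(1-4) lam] by blast
  show ?thesis
  proof (intro conjI)
    show "\<exists>X. finite X \<and> X \<subseteq> verts G \<and> v \<in> X \<and> graph_connected (G \<restriction> X) \<and>
        adj_eigenvalue (G \<restriction> X) lam \<and>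
        (\<exists>f. adj_eigenfunction (G \<restriction> X) lam f \<and> f \<in> X \<rightarrow>\<^sub>E ?K \<and> vertex_support (G \<restriction> X) f = X) \<and>
        (\<exists>Y. finite Y \<and> Y \<subseteq> verts G \<and> X \<subseteq> Y \<and> graph_connected (graph_square G \<restriction> Y) \<and>
           (\<forall>Z. finite Z \<and> Z \<subseteq> verts G \<and> Y \<subseteq> Z \<longrightarrow> adj_eigenvalue (G \<restriction> Z) lam \<and>
              (\<exists>f. adj_eigenfunction (G \<restriction> Z) lam f \<and> f \<in> Z \<rightarrow>\<^sub>E ?K \<and>
                   vertex_support (G \<restriction> Z) f = Y)))"
      by (intro exI[of _ X] exI[of _ Y] conjI allI impI X Y lam lamZ Z[rule_format]) simp_all
    show "algebraic_over prime_subfield lam" using p by (rule integral_imp_algebraic)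
    show "CHAR('f) > 0 \<longrightarrow> finite ?K" using finite_adjoin_integral[OF _ p] by blast
  qed (intro allI impI, elim conjE, rule poly, assumption+)
qed

end
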